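(* Let $n$ be a positive integer such that $n = pq$ and $n+12 = p'q'$, where $p<q$ are primes and $p'<q'$ are primes. Then both conditions $$\varphi(n+12)-\varphi(n)=12 \quad\text{and}\quad \sigma(n+12)-\sigma(n)=12$$ hold if and only if $p\ge 5$, $q=p+8$, and $\{p',q'\}=\{p+2,\,p+6\}$; that is, $(p,p',q',q)=(p,p+2,p+6,p+8)$ is a prime quadruplet (with $p \ge 5$).
   Context: $\varphi$ is Euler's totient function and $\sigma$ is the sum-of-divisors function on the positive integers. A prime quadruplet is a $4$-tuple of the form $(p,p+2,p+6,p+8)$ all of whose entries are prime. *)

theory Defs
  imports "HOL-Number_Theory.Totient"
begin

text \<open>
  Euler's function is the library's \<^const>\<open>totient\<close>. The argument 0 of \<open>divisor_sum\<close>
  is outside the intended domain (the set of divisors is then infinite and the sum is 0).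
\<close>

definition divisor_sum :: "nat \<Rightarrow> nat" where
  "divisor_sum n = (\<Sum>d | d dvd n. d)"

definition prime_quadruplet :: "nat \<times> nat \<times> nat \<times> nat \<Rightarrow> bool" where
  "prime_quadruplet t \<longleftrightarrow>
     (\<exists>p. t = (p, p + 2, p + 6, p + 8) \<and>
          prime p \<and> prime (p + 2) \<and> prime (p + 6) \<and> prime (p + 8))"

end

theory Submission
  imports Defs
begin

text \<open>
  For distinct primes \<open>p, q\<close> both \<open>totient (p * q) - p * q\<close> and \<open>divisor_sum (p * q) - p * q\<close>
  depend only on \<open>p + q\<close>, so either condition alone says \<open>p + q = p' + q'\<close>. Writing
  \<open>p' = p + a\<close> and \<open>q' = q - a\<close> turns \<open>p' * q' = p * q + 12\<close> into \<open>a * (q' - p) = 12\<close>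
  with \<open>a < q' - p\<close>, which leaves \<open>a = 1, 2, 3\<close>. For \<open>a = 1, 3\<close> the difference \<open>q - p\<close> is odd,
  forcing \<open>p = 2\<close> and a composite \<open>q\<close>; the quadruplet is the case \<open>a = 2\<close>.
\<close>

lemma totient_prime_product:
  fixes p q :: nat
  assumes "prime p" "prime q" "p \<noteq> q"
  shows "totient (p * q) + p + q = p * q + 1"
proof -
  have "totient (p * q) = (p - 1) * (q - 1)"
    using assms by (simp add: totient_mult_coprime primes_coprime totient_prime)
  \<comment> \<open>Successors remove the truncated subtraction in
    \<open>(p - 1) * (q - 1)\<close>.\<close>
  moreover obtain a b where "p = Suc a" "q = Suc b"
    using assms prime_gt_0_nat by (metis gr0_implies_Suc)
  ultimately show ?thesis by simp
qed

lemma divisors_prime_product: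
  fixes p q :: nat
  assumes "prime p" "prime q"
  shows "{d. d dvd p * q} = {1, p, q, p * q}"
proof (intro equalityI subsetI)
  fix d assume "d \<in> {d. d dvd p * q}"
  then obtain b c where "d = b * c" "b dvd p" "c dvd q"
    using division_decomp by blast
  moreover from this have "b = 1 \<or> b = p" "c = 1 \<or> c = q"
    using assms by (simp_all add: prime_nat_iff)
  ultimately show "d \<in> {1, p, q, p * q}" by auto
qed auto

lemma divisor_sum_prime_product:
  fixes p q :: nat
  assumes "prime p" "prime q" "p \<noteq> q"
  shows "divisor_sum (p * q) = p * q + p + q + 1"
proof -
  \<comment> \<open>Together with \<open>p \<noteq> q\<close> this makes the four listed divisors
    pairwise distinct, so no term of the sum collapses.\<close>
  have "p > 1" "q > 1"
    using assms prime_gt_1_nat by auto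
  then show ?thesis
    using assms(3) by (simp add: divisor_sum_def divisors_prime_product assms(1,2))
qed

lemma equal_sum_product_plus_12:
  fixes p q p' q' :: nat
  assumes sum: "p + q = p' + q'" and prod: "p' * q' = p * q + 12"
    and "p < q" "p' < q'"
  shows "\<exists>(a, b) \<in> {(1, 12), (2, 6), (3, 4)}. p' = p + a \<and> q' = p + b \<and> q = p + a + b"
proof -
  \<comment> \<open>For a fixed sum, spreading the factors apart cannot raise the product:
    \<open>p = p' + c\<close> would give
    \<open>p' * q' = p * q - c * (q - p') \<le> p * q\<close>.\<close>
  have "p < p'"
  proof (rule ccontr)
    assume "\<not> p < p'"
    then obtain c where c: "p = p' + c"
      using le_Suc_ex not_less by blast
    with sum have "q' = q + c" by simp
    then have "p' * q' + c * q = p * q + c * p'"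
      using c by (simp add: algebra_simps)
    moreover have "c * p' \<le> c * q"
      using c \<open>p < q\<close> by simp
    ultimately show False using prod by linarith
  qed
  then obtain a where a: "p' = p + a" "a > 0"
    using less_imp_add_positive by blast
  have "q' = p + (q' - p)" "a < q' - p"
    using a \<open>p' < q'\<close> by linarith+
  then obtain b where b: "q' = p + b" "a < b" ..
  have q: "q = p + a + b"
    using sum a b by simp
  have ab: "a * b = 12"
    using prod unfolding a b q by (simp add: algebra_simps)
  have "a < 4"
  proof (rule ccontr)
    assume "\<not> a < 4"
    \<comment> \<open>The 5 comes from \<open>a < b\<close>, and 20 already exceeds 12.\<close>
    then have "4 * 5 \<le> a * b"
      using b by (intro mult_le_mono) auto
    with ab show False by simp
  qed
  with a have "a = 1 \<or> a = 2 \<or> a = 3" by auto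
  with ab have "(a, b) \<in> {(1, 12), (2, 6), (3, 4)}" by auto
  with a b q show ?thesis by blast
qed

text \<open>Primes above 2 are odd, and two odd numbers differ by an even number.\<close>

lemma prime_pair_odd_difference:
  fixes p d :: nat
  assumes "prime p" "prime (p + d)" "odd d"
  shows "p = 2"
proof (rule ccontr)
  assume "p \<noteq> 2"
  with prime_ge_2_nat[OF assms(1)] have "p > 2" by simp
  then have "odd p" "odd (p + d)"
    using prime_odd_nat[OF assms(1)] prime_odd_nat[OF assms(2)] by simp_all
  with assms(3) show False by simp
qed

lemma equal_sum_prime_quadruplet:
  fixes p q p' q' :: nat
  assumes "prime p" "prime q" "prime q'" "p < q" "p' < q'"
    and "p + q = p' + q'" "p' * q' = p * q + 12"
  shows "p \<ge> 5 \<and> q = p + 8 \<and> p' = p + 2 \<and> q' = p + 6"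
proof -
  \<comment> \<open>Here 15 and 9 are the values of \<open>q\<close> at \<open>p = 2\<close> in the
    two odd cases. In the quadruplet case 10 is \<open>q\<close> at \<open>p = 2\<close>, 9 is
    \<open>q'\<close> at \<open>p = 3\<close>, and 4 is \<open>p\<close> itself.\<close>
  have nonprime: "\<not> prime (15::nat)" "\<not> prime (9::nat)" "\<not> prime (10::nat)" "\<not> prime (4::nat)"
    using prime_product[of 3 "5::nat"] prime_product[of 3 "3::nat"]
      prime_product[of 2 "5::nat"] prime_product[of 2 "2::nat"] by simp_all
  from equal_sum_product_plus_12[OF assms(6,7,4,5)]
  consider "q = p + 13" | "q = p + 7" | "p' = p + 2" "q' = p + 6" "q = p + 8"
    by auto
  then show ?thesis
  proof cases
    case 1
    with assms prime_pair_odd_difference[of p 13] nonprime show ?thesis by auto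
  next
    case 2
    with assms prime_pair_odd_difference[of p 7] nonprime show ?thesis by auto
  next
    case 3
    have "p \<noteq> 2" "p \<noteq> 3" "p \<noteq> 4"
      using 3 assms nonprime by auto
    with prime_ge_2_nat[OF \<open>prime p\<close>] 3 show ?thesis by auto
  qed
qed

theorem theorem2p2:
  fixes n p q p' q' :: nat
  assumes "n > 0"
    and "n = p * q" and "prime p" and "prime q" and "p < q"
    and "n + 12 = p' * q'" and "prime p'" and "prime q'" and "p' < q'"
  shows "((int (totient (n + 12)) - int (totient n) = 12 \<and>
           int (divisor_sum (n + 12)) - int (divisor_sum n) = 12)
          \<longleftrightarrow> (p \<ge> 5 \<and> q = p + 8 \<and> {p', q'} = {p + 2, p + 6})) \<and>
         ((p \<ge> 5 \<and> q = p + 8 \<and> {p', q'} = {p + 2, p + 6})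
          \<longleftrightarrow> ((p, p', q', q) = (p, p + 2, p + 6, p + 8) \<and>
               prime_quadruplet (p, p', q', q) \<and> p \<ge> 5))"
proof -
  \<comment> \<open>The ordering \<open>p' < q'\<close> excludes the swapped matching.\<close>
  have pair: "{p', q'} = {p + 2, p + 6} \<longleftrightarrow> p' = p + 2 \<and> q' = p + 6"
    using \<open>p' < q'\<close> by (auto simp: doubleton_eq_iff)
  have prod: "p' * q' = p * q + 12"
    using assms(2,6) by simp
  have "totient n + p + q = n + 1" "totient (n + 12) + p' + q' = n + 12 + 1"
    using totient_prime_product[of p q] totient_prime_product[of p' q'] assms by auto
  moreover have "divisor_sum n = n + p + q + 1" "divisor_sum (n + 12) = n + 12 + p' + q' + 1"
    using divisor_sum_prime_product[of p q] divisor_sum_prime_product[of p' q'] assms by auto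
  ultimately have "(int (totient (n + 12)) - int (totient n) = 12 \<and>
      int (divisor_sum (n + 12)) - int (divisor_sum n) = 12) \<longleftrightarrow> p + q = p' + q'"
    by linarith
  also have "\<dots> \<longleftrightarrow> p \<ge> 5 \<and> q = p + 8 \<and> p' = p + 2 \<and> q' = p + 6"
    using equal_sum_prime_quadruplet[OF assms(3,4,8,5,9) _ prod] by auto
  finally show ?thesis
    using assms(3,4,7,8) unfolding pair by (auto simp: prime_quadruplet_def)
qed

end
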